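(* Let $k,n$ be integers with $k\geq 1$, $n\ge 0$, let $\lambda$ be a partition, and let $1\le i\le k-1$. There exists an involution $g=g_i:\mathrm{SSOT}_{k,n}(\lambda)\to\mathrm{SSOT}_{k,n}(\lambda)$ such that for every $S\in\mathrm{SSOT}_{k,n}(\lambda)$, $$(\mathrm{wt}_i\,g(S),\ \mathrm{wt}_{i+1}\,g(S))=(\mathrm{wt}_{i+1}S,\ \mathrm{wt}_iS)$$ and $\mathrm{wt}_j\,g(S)=\mathrm{wt}_jS$ for all $j\ne i,i+1$.
   Context: Partitions are identified with Young diagrams in English notation. A skew shape is a horizontal strip if it contains at most one box in each column. A $k$-semistandard oscillating tableau ($k$-SSOT) of final shape $\lambda$ is a finite sequence of partitions $S=(S^{1},S'^{2},S^{2},S'^{3},\dots,S'^{k},S^{k})$ such that, with $S'^{1}=\emptyset$: $S^{i}\supseteq S'^{i+1}$ and $S^i\setminus S'^{i+1}$ is a (possibly empty) horizontal strip for $1\le i\le k-1$; $S'^{i}\subseteq S^{i}$ and $S^i\setminus S'^i$ is a (possibly empty) horizontal strip for $1\le i\le k$; and $S^k=\lambda$. Step $i$ consists of deleting the boxes of $S^{i-1}\setminus S'^{i}$ (for $i\ge2$) and then adding the boxes of $S^i\setminus S'^i$. $S$ is identified with the multiset-valued tableau in which the letter $i$ is recorded at a box position once for each time that box is added or deleted in step $i$. $\mathrm{wt}_iS$ is the total number of letters $i$ in this multiset-valued tableau, i.e. the total number of boxes deleted and added in step $i$. The length of $S$ is the total number of letters, $\sum_i\mathrm{wt}_iS$.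 $\mathrm{SSOT}_{k,n}(\lambda)$ is the set of $k$-SSOTs of final shape $\lambda$ and length $n$. *)

theory Defs
  imports Complex_Main "HOL-Library.Multiset" "HOL-Library.FuncSet"
begin

text \<open>A partition is the list of its parts. Boxes are pairs (row, column), counted from 0, with
  rows numbered downwards (English notation).\<close>

definition is_partition :: "nat list \<Rightarrow> bool" where
  "is_partition p \<longleftrightarrow> sorted_wrt (\<ge>) p \<and> 0 \<notin> set p"

definition diagram :: "nat list \<Rightarrow> (nat \<times> nat) set" where
  "diagram p = {(r, c). r < length p \<and> c < p ! r}"

definition horizontal_strip :: "(nat \<times> nat) set \<Rightarrow> bool" where
  "horizontal_strip B \<longleftrightarrow> (\<forall>r r' c. (r, c) \<in> B \<and> (r', c) \<in> B \<longrightarrow> r = r')"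

text \<open>A \<open>k\<close>-SSOT is the list \<open>[S\<^sup>1, S'\<^sup>2, S\<^sup>2, \<dots>, S'\<^sup>k, S\<^sup>k]\<close> of length \<open>2 * k - 1\<close>. For
  \<open>1 \<le> i \<le> k\<close>, \<open>upper S i\<close> is \<open>S\<^sup>i\<close> and \<open>lower S i\<close> is \<open>S'\<^sup>i\<close>, where \<open>S'\<^sup>1\<close> is the empty partition,
  which is not stored in the list.\<close>

definition upper :: "nat list list \<Rightarrow> nat \<Rightarrow> nat list" where
  "upper S i = S ! (2 * i - 2)"

definition lower :: "nat list list \<Rightarrow> nat \<Rightarrow> nat list" where
  "lower S i = (if i \<le> 1 then [] else S ! (2 * i - 3))"

definition added :: "nat list list \<Rightarrow> nat \<Rightarrow> (nat \<times> nat) set" where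
  "added S i = diagram (upper S i) - diagram (lower S i)"

definition deleted :: "nat list list \<Rightarrow> nat \<Rightarrow> (nat \<times> nat) set" where
  "deleted S i = (if i \<le> 1 then {} else diagram (upper S (i - 1)) - diagram (lower S i))"

definition is_SSOT :: "nat \<Rightarrow> nat list \<Rightarrow> nat list list \<Rightarrow> bool" where
  "is_SSOT k lam S \<longleftrightarrow>
     length S = 2 * k - 1 \<and> (\<forall>p \<in> set S. is_partition p) \<and>
     (\<forall>i \<in> {1..k-1}. diagram (lower S (i + 1)) \<subseteq> diagram (upper S i) \<and>
        horizontal_strip (diagram (upper S i) - diagram (lower S (i + 1)))) \<and>
     (\<forall>i \<in> {1..k}. diagram (lower S i) \<subseteq> diagram (upper S i) \<and>
        horizontal_strip (diagram (upper S i) - diagram (lower S i))) \<and>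
     upper S k = lam"

text \<open>The multiset-valued tableau: a box which is both deleted and added in step \<open>i\<close> receives the
  letter \<open>i\<close> twice. The number of steps is recovered from the length \<open>2 * k - 1\<close> of the list.\<close>

definition tableau :: "nat list list \<Rightarrow> nat \<times> nat \<Rightarrow> nat multiset" where
  "tableau S b = (\<Sum>i = 1..(length S + 1) div 2.
     replicate_mset (of_bool (b \<in> deleted S i) + of_bool (b \<in> added S i)) i)"

definition wt :: "nat \<Rightarrow> nat list list \<Rightarrow> nat" where
  "wt i S = (\<Sum>b | tableau S b \<noteq> {#}. count (tableau S b) i)"

definition len :: "nat list list \<Rightarrow> nat" where
  "len S = (\<Sum>b | tableau S b \<noteq> {#}. size (tableau S b))"

definition SSOT :: "nat \<Rightarrow> nat \<Rightarrow> nat list \<Rightarrow> nat list list set" where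
  "SSOT k n lam = {S. is_SSOT k lam S \<and> len S = n}"

lemma finite_diagram: "finite (diagram p)"
proof -
  have "diagram p = (SIGMA r:{..<length p}. {..<p ! r})"
    by (auto simp: diagram_def)
  then show ?thesis by simp
qed

lemma finite_added: "finite (added S i)"
  and finite_deleted: "finite (deleted S i)"
  by (simp_all add: added_def deleted_def finite_diagram)

lemma count_tableau:
  "count (tableau S b) i = (if i \<in> {1..(length S + 1) div 2}
     then of_bool (b \<in> deleted S i) + of_bool (b \<in> added S i) else 0)"
  unfolding tableau_def count_sum by (simp add: if_distrib cong: if_cong)

lemma finite_tableau_support: "finite {b. tableau S b \<noteq> {#}}"
proof (rule finite_subset)
  show "{b. tableau S b \<noteq> {#}} \<subseteq> (\<Union>i \<in> {1..(length S + 1) div 2}. deleted S i \<union> added S i)"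
  proof
    fix b assume "b \<in> {b. tableau S b \<noteq> {#}}"
    then obtain i where "count (tableau S b) i \<noteq> 0"
      by (auto simp: multiset_eq_iff)
    then show "b \<in> (\<Union>i \<in> {1..(length S + 1) div 2}. deleted S i \<union> added S i)"
      by (auto simp: count_tableau split: if_splits)
  qed
qed (simp add: finite_added finite_deleted)

text \<open>For a \<open>k\<close>-SSOT the bound on \<open>i\<close> below is \<open>k\<close>.\<close>

lemma wt_eq_card:
  assumes "1 \<le> i" "i \<le> (length S + 1) div 2"
  shows "wt i S = card (deleted S i) + card (added S i)"
proof -
  let ?A = "{b. tableau S b \<noteq> {#}}"
  have c: "count (tableau S b) i = of_bool (b \<in> deleted S i) + of_bool (b \<in> added S i)" for b
    using assms by (simp add: count_tableau)
  have sub: "deleted S i \<subseteq> ?A" "added S i \<subseteq> ?A"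
  proof -
    have "b \<in> ?A" if "b \<in> deleted S i \<union> added S i" for b
    proof -
      have "count (tableau S b) i \<noteq> 0" using c[of b] that by auto
      then show ?thesis by auto
    qed
    then show "deleted S i \<subseteq> ?A" "added S i \<subseteq> ?A" by blast+
  qed
  have "wt i S = (\<Sum>b\<in>?A. of_bool (b \<in> deleted S i)) + (\<Sum>b\<in>?A. of_bool (b \<in> added S i))"
    by (simp add: wt_def c sum.distrib)
  also have "\<dots> = card (?A \<inter> deleted S i) + card (?A \<inter> added S i)"
    using finite_tableau_support[of S] by (simp add: of_bool_def sum.If_cases)
  finally show ?thesis using sub by (simp add: Int_absorb1)
qed

lemma len_eq_sum_wt: "len S = (\<Sum>i = 1..(length S + 1) div 2. wt i S)"
proof -
  have "size (tableau S b) = (\<Sum>i = 1..(length S + 1) div 2. count (tableau S b) i)" for b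
    unfolding size_multiset_overloaded_eq
    by (rule sum.mono_neutral_left)
      (auto simp: count_tableau not_in_iff simp flip: count_greater_zero_iff split: if_splits)
  then show ?thesis
    unfolding len_def wt_def by (simp only: sum.swap[of _ "{1.._}"])
qed

end

theory Submission
  imports Defs
begin

text \<open>Fix \<open>p = S\<^bsup>i-1\<^esup>\<close> and \<open>q = S\<^bsup>i+1\<^esup>\<close>; only \<open>a = S'\<^sup>i\<close>, \<open>b = S\<^sup>i\<close>, \<open>c = S'\<^bsup>i+1\<^esup>\<close> change. In terms of
  row lengths a horizontal strip is an interlacing condition. Given \<open>a \<subseteq> b \<supseteq> c\<close>, row \<open>j + 1\<close> of \<open>b\<close>
  ranges over the same interval \<open>[max a\<^bsub>j+1\<^esub> c\<^bsub>j+1\<^esub>, min a\<^sub>j c\<^sub>j]\<close> as row \<open>j\<close> of a partition \<open>d\<close> with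
  \<open>a \<supseteq> d \<subseteq> c\<close>. Reflecting this interval, and recording the excess \<open>m\<close> of the first row of \<open>b\<close>,
  turns \<open>b\<close> bijectively into \<open>(d, m)\<close>, where \<open>|b| + |d| = m + |a| + |c|\<close>.
  In the chains \<open>p \<supseteq> a \<supseteq> d\<close> and \<open>q \<supseteq> c \<supseteq> d\<close> one then reflects \<open>a\<close> and \<open>c\<close> in their ranges, which
  gives \<open>|a'| + |a| = |p| + |d|\<close> and \<open>|c'| + |c| = |q| + |d|\<close>, and finally passes back from
  \<open>(d, m)\<close> to \<open>b'\<close>. The three size identities imply that the weights of steps \<open>i\<close> and \<open>i + 1\<close> are
  interchanged.\<close>

section \<open>Interlacing sequences and reflections of rows\<close>

definition interlaced :: "(nat \<Rightarrow> nat) \<Rightarrow> (nat \<Rightarrow> nat) \<Rightarrow> bool" where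
  "interlaced p q \<longleftrightarrow> (\<forall>j. q j \<le> p j \<and> p (Suc j) \<le> q j)"

definition shrink :: "(nat \<Rightarrow> nat) \<Rightarrow> (nat \<Rightarrow> nat) \<Rightarrow> (nat \<Rightarrow> nat) \<Rightarrow> nat \<Rightarrow> nat" where
  "shrink a c b j = max (a (Suc j)) (c (Suc j)) + min (a j) (c j) - b (Suc j)"

text \<open>Row 0 is bounded only from below, so it cannot be reflected and is given by its excess
  \<open>m\<close> instead.\<close>

definition grow :: "(nat \<Rightarrow> nat) \<Rightarrow> (nat \<Rightarrow> nat) \<Rightarrow> nat \<Rightarrow> (nat \<Rightarrow> nat) \<Rightarrow> nat \<Rightarrow> nat" where
  "grow a c m d j = (case j of 0 \<Rightarrow> max (a 0) (c 0) + m
     | Suc l \<Rightarrow> max (a (Suc l)) (c (Suc l)) + min (a l) (c l) - d l)"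

text \<open>The piecewise-linear form of the Bender-Knuth involution on Gelfand-Tsetlin patterns:
  \<open>a j\<close> is reflected in the interval cut out by its neighbours in \<open>p\<close> and
  \<open>d\<close>, where row 0 has no neighbour in \<open>d\<close> above it.\<close>

definition bender_knuth :: "(nat \<Rightarrow> nat) \<Rightarrow> (nat \<Rightarrow> nat) \<Rightarrow> (nat \<Rightarrow> nat) \<Rightarrow> nat \<Rightarrow> nat" where
  "bender_knuth p d a j =
     max (p (Suc j)) (d j) + (case j of 0 \<Rightarrow> p 0 | Suc l \<Rightarrow> min (p (Suc l)) (d l)) - a j"

lemma interlacedI:
  assumes "\<And>j. q j \<le> p j" "\<And>j. p (Suc j) \<le> q j"
  shows "interlaced p q"
  using assms by (simp add: interlaced_def)

lemma interlacedD:
  assumes "interlaced p q"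
  shows "q j \<le> p j" "p (Suc j) \<le> q j"
  using assms by (simp_all add: interlaced_def)

text \<open>Interlacing puts \<open>b (Suc j)\<close> between
  \<open>max (a (Suc j)) (c (Suc j))\<close> and \<open>min (a j) (c j)\<close>. Its reflection
  stays there, and the subtraction is exact.\<close>

lemma interlaced_shrink:
  assumes "interlaced b a" "interlaced b c"
  shows "interlaced a (shrink a c b)" "interlaced c (shrink a c b)"
proof -
  note D = interlacedD[OF assms(1)] interlacedD[OF assms(2)]
  have "shrink a c b j \<le> min (a j) (c j)" "max (a (Suc j)) (c (Suc j)) \<le> shrink a c b j" for j
    using D[of j] D[of "Suc j"] unfolding shrink_def by linarith+
  then show "interlaced a (shrink a c b)" "interlaced c (shrink a c b)"
    by (simp_all add: interlaced_def)
qed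

lemma interlaced_grow:
  assumes "interlaced a d" "interlaced c d"
  shows "interlaced (grow a c m d) a" "interlaced (grow a c m d) c"
proof -
  note D = interlacedD[OF assms(1)] interlacedD[OF assms(2)]
  have "max (a j) (c j) \<le> grow a c m d j" for j
    using D[of j] D[of "j - 1"] unfolding grow_def by (cases j) (simp, simp, linarith)
  moreover have "grow a c m d (Suc j) \<le> min (a j) (c j)" for j
    using D[of j] unfolding grow_def nat.case by linarith
  ultimately show "interlaced (grow a c m d) a" "interlaced (grow a c m d) c"
    by (simp_all add: interlaced_def)
qed

lemma shrink_grow:
  assumes "interlaced a d" "interlaced c d"
  shows "shrink a c (grow a c m d) = d"
proof
  fix j
  show "shrink a c (grow a c m d) j = d j"
    using interlacedD[OF assms(1), of j] interlacedD[OF assms(2), of j]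
    unfolding shrink_def grow_def nat.case by linarith
qed

lemma grow_shrink:
  assumes "interlaced b a" "interlaced b c"
  shows "grow a c (b 0 - max (a 0) (c 0)) (shrink a c b) = b"
proof
  fix j
  note D = interlacedD[OF assms(1)] interlacedD[OF assms(2)]
  show "grow a c (b 0 - max (a 0) (c 0)) (shrink a c b) j = b j"
  proof (cases j)
    case 0
    show ?thesis
      using D[of 0] unfolding 0 grow_def nat.case by linarith
  next
    case (Suc l)
    show ?thesis
      using D[of l] D[of "Suc l"] unfolding Suc grow_def shrink_def nat.case by linarith
  qed
qed

text \<open>Interlacing confines \<open>a j\<close> to the interval, so the truncated subtraction is
  exact. The third claim is the additive form of the reflection, from which involutivity and the
  size identity follow.\<close>

lemma bender_knuth_bounds:
  assumes "interlaced p a" "interlaced a d"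
  shows "max (p (Suc j)) (d j) \<le> bender_knuth p d a j"
    and "bender_knuth p d a j \<le> (case j of 0 \<Rightarrow> p 0 | Suc l \<Rightarrow> min (p (Suc l)) (d l))"
    and "bender_knuth p d a j + a j =
      max (p (Suc j)) (d j) + (case j of 0 \<Rightarrow> p 0 | Suc l \<Rightarrow> min (p (Suc l)) (d l))"
proof -
  have lower: "max (p (Suc j)) (d j) \<le> a j"
    using interlacedD[OF assms(1), of j] interlacedD[OF assms(2), of j] by simp
  have upper: "a j \<le> (case j of 0 \<Rightarrow> p 0 | Suc l \<Rightarrow> min (p (Suc l)) (d l))"
    using interlacedD[OF assms(1), of j] interlacedD[OF assms(2), of "j - 1"] by (cases j) simp_all
  show "max (p (Suc j)) (d j) \<le> bender_knuth p d a j"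
    and "bender_knuth p d a j \<le> (case j of 0 \<Rightarrow> p 0 | Suc l \<Rightarrow> min (p (Suc l)) (d l))"
    and "bender_knuth p d a j + a j =
      max (p (Suc j)) (d j) + (case j of 0 \<Rightarrow> p 0 | Suc l \<Rightarrow> min (p (Suc l)) (d l))"
    using lower upper unfolding bender_knuth_def by linarith+
qed

lemma interlaced_bender_knuth:
  assumes "interlaced p a" "interlaced a d"
  shows "interlaced p (bender_knuth p d a)" "interlaced (bender_knuth p d a) d"
proof -
  note B = bender_knuth_bounds[OF assms]
  show "interlaced p (bender_knuth p d a)"
  proof (rule interlacedI)
    fix j
    show "bender_knuth p d a j \<le> p j" using B(2)[of j] by (cases j) simp_all
    show "p (Suc j) \<le> bender_knuth p d a j" using B(1)[of j] by simp
  qed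
  show "interlaced (bender_knuth p d a) d"
  proof (rule interlacedI)
    fix j
    show "d j \<le> bender_knuth p d a j" using B(1)[of j] by simp
    show "bender_knuth p d a (Suc j) \<le> d j" using B(2)[of "Suc j"] by simp
  qed
qed

lemma bender_knuth_bender_knuth:
  assumes "interlaced p a" "interlaced a d"
  shows "bender_knuth p d (bender_knuth p d a) = a"
proof
  fix j
  show "bender_knuth p d (bender_knuth p d a) j = a j"
    using bender_knuth_bounds(3)[OF assms, of j]
      bender_knuth_bounds(3)[OF interlaced_bender_knuth[OF assms], of j] by linarith
qed

section \<open>Size identities\<close>

text \<open>Each reflection contributes a maximum at \<open>Suc j\<close> and a minimum at
  \<open>j\<close>. The maximum meets the minimum at the same index one row later, and the two add
  up to \<open>a + c\<close>; only boundary terms remain.\<close>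

lemma sum_shrink:
  assumes "interlaced b a" "interlaced b c"
  shows "(\<Sum>j<Suc N. b j) + (\<Sum>j<N. shrink a c b j) + max (a 0) (c 0)
    = b 0 + (\<Sum>j<N. a j) + (\<Sum>j<N. c j) + max (a N) (c N)"
proof (induction N)
  case (Suc N)
  have "b (Suc N) + shrink a c b N = max (a (Suc N)) (c (Suc N)) + min (a N) (c N)"
    using interlacedD[OF assms(1), of N] interlacedD[OF assms(2), of N]
      interlacedD[OF assms(1), of "Suc N"] interlacedD[OF assms(2), of "Suc N"]
    unfolding shrink_def by linarith
  moreover have "max (a N) (c N) + min (a N) (c N) = a N + c N" by linarith
  ultimately show ?case using Suc.IH by simp
qed simp

text \<open>The maximum of \<open>p (Suc j)\<close> and \<open>d j\<close> from row \<open>j\<close>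
  is paired with their minimum from row \<open>Suc j\<close>. The last maximum has no partner yet,
  which explains the minimum on the left.\<close>

lemma sum_bender_knuth:
  assumes "interlaced p a" "interlaced a d"
  shows "(\<Sum>j<Suc N. bender_knuth p d a j) + (\<Sum>j<Suc N. a j) + min (p (Suc N)) (d N)
    = (\<Sum>j<Suc N. p j) + (\<Sum>j<Suc N. d j) + p (Suc N)"
proof (induction N)
  case 0
  show ?case using bender_knuth_bounds(3)[OF assms, of 0] by simp
next
  case (Suc N)
  show ?case
    using bender_knuth_bounds(3)[OF assms, of "Suc N"] Suc.IH by simp
qed

section \<open>The toggle on triples of row functions\<close>

fun toggle :: "(nat \<Rightarrow> nat) \<Rightarrow> (nat \<Rightarrow> nat) \<Rightarrow> (nat \<Rightarrow> nat) \<times> (nat \<Rightarrow> nat) \<times> (nat \<Rightarrow> nat)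
    \<Rightarrow> (nat \<Rightarrow> nat) \<times> (nat \<Rightarrow> nat) \<times> (nat \<Rightarrow> nat)" where
  "toggle p q (a, b, c) =
    (let d = shrink a c b; a' = bender_knuth p d a; c' = bender_knuth q d c
     in (a', grow a' c' (b 0 - max (a 0) (c 0)) d, c'))"

context
  fixes p q a b c a' b' c'
  assumes pa: "interlaced p a" and ba: "interlaced b a"
    and bc: "interlaced b c" and qc: "interlaced q c"
    and toggle: "toggle p q (a, b, c) = (a', b', c')"
begin

lemma toggle_components:
  defines "d \<equiv> shrink a c b"
  shows "interlaced a d" "interlaced c d" "interlaced a' d" "interlaced c' d"
    "a' = bender_knuth p d a" "c' = bender_knuth q d c"
    "b' = grow a' c' (b 0 - max (a 0) (c 0)) d" "shrink a' c' b' = d"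
proof -
  show d: "interlaced a d" "interlaced c d"
    unfolding d_def by (rule interlaced_shrink[OF ba bc])+
  show a': "a' = bender_knuth p d a" and c': "c' = bender_knuth q d c"
    and b': "b' = grow a' c' (b 0 - max (a 0) (c 0)) d"
    using toggle by (auto simp: Let_def d_def)
  show d': "interlaced a' d" "interlaced c' d"
    unfolding a' c' by (rule interlaced_bender_knuth pa qc d)+
  show "shrink a' c' b' = d"
    unfolding b' by (rule shrink_grow[OF d'])
qed

lemma interlaced_toggle:
  "interlaced p a'" "interlaced b' a'" "interlaced b' c'" "interlaced q c'"
proof -
  show "interlaced p a'" "interlaced q c'"
    unfolding toggle_components(5,6)
    by (rule interlaced_bender_knuth pa qc toggle_components)+
  show "interlaced b' a'" "interlaced b' c'"
    unfolding toggle_components(7)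
    by (rule interlaced_grow toggle_components)+
qed

text \<open>\<open>d\<close> and the excess of row 0 survive the toggle, and for fixed
  \<open>d\<close> the reflections of \<open>a\<close> and \<open>c\<close> are involutions.\<close>

lemma toggle_toggle: "toggle p q (a', b', c') = (a, b, c)"
proof -
  have "b' 0 - max (a' 0) (c' 0) = b 0 - max (a 0) (c 0)"
    unfolding toggle_components(7) by (simp add: grow_def)
  moreover have "bender_knuth p (shrink a c b) a' = a"
    unfolding toggle_components(5) by (rule bender_knuth_bender_knuth pa toggle_components)+
  moreover have "bender_knuth q (shrink a c b) c' = c"
    unfolding toggle_components(6) by (rule bender_knuth_bender_knuth qc toggle_components)+
  ultimately show ?thesis
    by (simp add: Let_def toggle_components(8) grow_shrink[OF ba bc])
qed

text \<open>In total sizes the first claim is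
  \<open>(p - a') + (b' - a') = (b - c) + (q - c)\<close>, freed of subtraction; the second is its
  mirror image. The range is \<open>Suc N\<close> because \<open>b\<close> and \<open>b'\<close> may
  still have a row \<open>N\<close>.\<close>

lemma sum_toggle:
  assumes "\<And>j. j \<ge> N \<Longrightarrow> p j = 0" "\<And>j. j \<ge> N \<Longrightarrow> q j = 0"
  shows "(\<Sum>j<Suc N. p j) + (\<Sum>j<Suc N. b' j) + 2 * (\<Sum>j<Suc N. c j)
      = (\<Sum>j<Suc N. q j) + (\<Sum>j<Suc N. b j) + 2 * (\<Sum>j<Suc N. a' j)"
    and "(\<Sum>j<Suc N. q j) + (\<Sum>j<Suc N. b' j) + 2 * (\<Sum>j<Suc N. a j)
      = (\<Sum>j<Suc N. p j) + (\<Sum>j<Suc N. b j) + 2 * (\<Sum>j<Suc N. c' j)"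
proof -
  let ?d = "shrink a c b"
  \<comment> \<open>These zeros remove the boundary terms at the upper end of the size
    identities.\<close>
  have z: "a N = 0" "c N = 0" "a' N = 0" "c' N = 0" "?d N = 0" "p N = 0" "q N = 0"
      "p (Suc N) = 0" "q (Suc N) = 0"
    using assms[of N] assms[of "Suc N"] interlacedD(1)[OF pa, of N] interlacedD(1)[OF qc, of N]
      interlacedD(1)[OF interlaced_toggle(1), of N] interlacedD(1)[OF interlaced_toggle(4), of N]
      interlacedD(1)[OF toggle_components(1), of N] by auto
  have b: "b' 0 + max (a 0) (c 0) = max (a' 0) (c' 0) + b 0"
    using interlacedD(1)[OF ba, of 0] interlacedD(1)[OF bc, of 0]
    by (simp add: toggle_components(7) grow_def)
  note sums = sum_shrink[OF ba bc, of N]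
    sum_shrink[OF interlaced_toggle(2,3), of N, unfolded toggle_components(8)]
    sum_bender_knuth[OF pa toggle_components(1), of N, folded toggle_components(5)]
    sum_bender_knuth[OF qc toggle_components(2), of N, folded toggle_components(6)]
  show "(\<Sum>j<Suc N. p j) + (\<Sum>j<Suc N. b' j) + 2 * (\<Sum>j<Suc N. c j)
      = (\<Sum>j<Suc N. q j) + (\<Sum>j<Suc N. b j) + 2 * (\<Sum>j<Suc N. a' j)"
    and "(\<Sum>j<Suc N. q j) + (\<Sum>j<Suc N. b' j) + 2 * (\<Sum>j<Suc N. a j)
      = (\<Sum>j<Suc N. p j) + (\<Sum>j<Suc N. b j) + 2 * (\<Sum>j<Suc N. c' j)"
    using sums b unfolding sum.lessThan_Suc z max.idem min.idem add_0_right
    by - linarith+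
qed

end


section \<open>Partitions as row functions, strips as interlacing\<close>

definition row :: "nat list \<Rightarrow> nat \<Rightarrow> nat" where
  "row p j = (if j < length p then p ! j else 0)"

text \<open>The list is cut at the first zero of \<open>f\<close>. Without a zero
  \<open>LEAST\<close> is unspecified, hence the zero assumed in \<open>row_of_rows\<close>.\<close>

definition of_rows :: "(nat \<Rightarrow> nat) \<Rightarrow> nat list" where
  "of_rows f = map f [0..<LEAST j. f j = 0]"

lemma diagram_eq_row: "diagram p = {(r, c). c < row p r}"
  by (auto simp: diagram_def row_def split: if_splits)

lemma row_pos: "is_partition p \<Longrightarrow> j < length p \<Longrightarrow> 0 < row p j"
  by (force simp: is_partition_def row_def in_set_conv_nth)

lemma antimono_row: "is_partition p \<Longrightarrow> antimono (row p)"
  by (auto simp: is_partition_def row_def sorted_wrt_iff_nth_less intro!: decseq_SucI)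

lemma of_rows_row:
  assumes "is_partition p"
  shows "of_rows (row p) = p"
proof -
  have "(LEAST j. row p j = 0) = length p"
  proof (rule Least_equality)
    show "row p (length p) = 0" by (simp add: row_def)
    show "length p \<le> j" if "row p j = 0" for j
      using row_pos[OF assms, of j] that by linarith
  qed
  then show ?thesis
    by (auto simp: of_rows_def row_def intro: nth_equalityI)
qed

lemma is_partition_of_rows: "antimono f \<Longrightarrow> is_partition (of_rows f)"
  unfolding is_partition_def of_rows_def
  by (auto simp: sorted_wrt_map sorted_wrt_iff_nth_less antimono_def dest: not_less_Least)

lemma row_of_rows:
  assumes "antimono f" "f N = 0"
  shows "row (of_rows f) = f"
proof
  fix j
  show "row (of_rows f) j = f j"
    using antimonoD[OF assms(1), of "LEAST j. f j = 0" j] LeastI[of "\<lambda>j. f j = 0", OF assms(2)]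
    by (auto simp: row_def of_rows_def)
qed

lemma interlaced_antimono:
  assumes "interlaced p q"
  shows "antimono p" "antimono q"
  by (rule decseq_SucI, meson interlacedD[OF assms] le_trans)+

definition strip :: "nat list \<Rightarrow> nat list \<Rightarrow> bool" where
  "strip p q \<longleftrightarrow> is_partition p \<and> is_partition q \<and> diagram q \<subseteq> diagram p \<and>
     horizontal_strip (diagram p - diagram q)"

lemma strip_iff_interlaced:
  "strip p q \<longleftrightarrow> is_partition p \<and> is_partition q \<and> interlaced (row p) (row q)"
proof (cases "is_partition p \<and> is_partition q")
  case True
  note anti = antimonoD[OF antimono_row]
  show ?thesis
  proof
    assume "strip p q"
    then have sub: "c < row q r \<Longrightarrow> c < row p r"
      and hs: "\<lbrakk>c < row p r; \<not> c < row q r; c < row p r'; \<not> c < row q r'\<rbrakk> \<Longrightarrow> r = r'" for r r' c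
      by (auto simp: strip_def diagram_eq_row horizontal_strip_def)
    have "interlaced (row p) (row q)"
    proof (rule interlacedI)
      fix j
      show "row q j \<le> row p j" using sub[of "row p j" j] by linarith
      show "row p (Suc j) \<le> row q j"
      proof (rule leI, rule notI)
        assume "row q j < row p (Suc j)"
        moreover have "row p (Suc j) \<le> row p j" "row q (Suc j) \<le> row q j"
          using True anti[of _ j "Suc j"] by auto
        \<comment> \<open>\<open>row q j\<close> is the first column to the right of
          \<open>q\<close> in row \<open>j\<close>; rows \<open>j\<close> and \<open>Suc j\<close>
          would both have a box of the strip there.\<close>
        ultimately have "j = Suc j" by (intro hs[of "row q j"]) auto
        then show False by simp
      qed
    qed
    then show "is_partition p \<and> is_partition q \<and> interlaced (row p) (row q)"
      using True by simp
  next
    assume "is_partition p \<and> is_partition q \<and> interlaced (row p) (row q)"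
    then have D: "row q j \<le> row p j" "row p (Suc j) \<le> row q j" for j
      using interlacedD by blast+
    \<comment> \<open>Applied in both directions to two strip boxes of one column, this makes their
      rows equal.\<close>
    have le: "r' \<le> r" if "c < row p r'" "\<not> c < row q r" for c r r'
    proof (rule leI, rule notI)
      assume "r < r'"
      then have "row p r' \<le> row p (Suc r)" using anti[of p "Suc r" r'] True by simp
      with D(2)[of r] that show False by linarith
    qed
    have "horizontal_strip (diagram p - diagram q)"
      unfolding horizontal_strip_def diagram_eq_row
      by (intro allI impI le_antisym; rule le; auto)
    moreover have "diagram q \<subseteq> diagram p"
      unfolding diagram_eq_row using less_le_trans[OF _ D(1)] by auto
    ultimately show "strip p q" using True by (simp add: strip_def)
  qed
qed (auto simp: strip_def)

lemma card_diagram_diff: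
  assumes "diagram q \<subseteq> diagram p" "\<And>j. j \<ge> N \<Longrightarrow> row p j = 0"
  shows "card (diagram p - diagram q) + (\<Sum>j<N. row q j) = (\<Sum>j<N. row p j)"
proof -
  have "row q j = 0" if "j \<ge> N" for j
    using assms(1) assms(2)[OF that] by (fastforce simp: diagram_eq_row)
  then have "diagram p = (SIGMA j:{..<N}. {..<row p j})" "diagram q = (SIGMA j:{..<N}. {..<row q j})"
    using assms(2) by (auto simp: diagram_eq_row) (metis leI less_nat_zero_code)+
  then have "card (diagram p) = (\<Sum>j<N. row p j)" "card (diagram q) = (\<Sum>j<N. row q j)"
    by simp_all
  then show ?thesis
    using card_Diff_subset[OF finite_diagram assms(1)] card_mono[OF finite_diagram assms(1)] by simp
qed

section \<open>The toggle on partitions\<close>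

definition toggle_partitions :: "nat list \<Rightarrow> nat list \<Rightarrow> nat list \<times> nat list \<times> nat list
    \<Rightarrow> nat list \<times> nat list \<times> nat list" where
  "toggle_partitions p q t = (case t of (x, y, z) \<Rightarrow>
     case toggle (row p) (row q) (row x, row y, row z) of (a, b, c) \<Rightarrow>
       (of_rows a, of_rows b, of_rows c))"

context
  fixes p q x y z x' y' z'
  assumes px: "strip p x" and yx: "strip y x" and yz: "strip y z" and qz: "strip q z"
    and toggle: "toggle_partitions p q (x, y, z) = (x', y', z')"
begin

text \<open>The toggled row functions are antimono and vanish eventually, so passing to lists of
  parts loses nothing and the results on row functions carry over.\<close>

lemma toggle_rows: "toggle (row p) (row q) (row x, row y, row z) = (row x', row y', row z')"
  and is_partition_toggle: "is_partition x'" "is_partition y'" "is_partition z'"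
proof -
  note I = px[unfolded strip_iff_interlaced] yx[unfolded strip_iff_interlaced]
    yz[unfolded strip_iff_interlaced] qz[unfolded strip_iff_interlaced]
  obtain a b c where abc: "toggle (row p) (row q) (row x, row y, row z) = (a, b, c)"
    by (rule prod_cases3)
  then have xyz: "x' = of_rows a" "y' = of_rows b" "z' = of_rows c"
    using toggle by (simp_all add: toggle_partitions_def)
  have T: "interlaced (row p) a" "interlaced b a" "interlaced b c" "interlaced (row q) c"
    using interlaced_toggle[OF _ _ _ _ abc] I by blast+
  have "a (length p) = 0" "c (length q) = 0"
    using interlacedD(1)[OF T(1), of "length p"] interlacedD(1)[OF T(4), of "length q"]
    by (simp_all add: row_def)
  \<comment> \<open>\<open>b\<close> can have one row more than \<open>p\<close>, since interlacing
    bounds \<open>b (Suc j)\<close> only by \<open>a j\<close>.\<close>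
  moreover from this(1) have "b (Suc (length p)) = 0"
    using interlacedD(2)[OF T(2), of "length p"] by simp
  ultimately show "toggle (row p) (row q) (row x, row y, row z) = (row x', row y', row z')"
    using row_of_rows interlaced_antimono[OF T(2)] interlaced_antimono[OF T(3)]
    unfolding abc xyz by metis
  show "is_partition x'" "is_partition y'" "is_partition z'"
    using is_partition_of_rows interlaced_antimono[OF T(2)] interlaced_antimono[OF T(3)]
    unfolding xyz by blast+
qed

lemma strip_toggle: "strip p x'" "strip y' x'" "strip y' z'" "strip q z'"
  using interlaced_toggle[OF _ _ _ _ toggle_rows] is_partition_toggle px yx yz qz
  unfolding strip_iff_interlaced by blast+

lemma toggle_partitions_toggle_partitions: "toggle_partitions p q (x', y', z') = (x, y, z)"
proof -
  have "toggle (row p) (row q) (row x', row y', row z') = (row x, row y, row z)"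
    using toggle_toggle[OF _ _ _ _ toggle_rows] px yx yz qz
    unfolding strip_iff_interlaced by blast
  then show ?thesis
    using px yx yz unfolding strip_iff_interlaced by (simp add: toggle_partitions_def of_rows_row)
qed

text \<open>The left sides become the new weights of steps \<open>i\<close> and
  \<open>i + 1\<close>, the right sides the old weights of steps \<open>i + 1\<close> and
  \<open>i\<close>.\<close>

lemma card_toggle:
  "card (diagram p - diagram x') + card (diagram y' - diagram x')
    = card (diagram y - diagram z) + card (diagram q - diagram z)"
  "card (diagram y' - diagram z') + card (diagram q - diagram z')
    = card (diagram p - diagram x) + card (diagram y - diagram x)"
proof -
  define N where "N = length p + length q + length y + length y'"
  have z: "row p j = 0" "row q j = 0" "row y j = 0" "row y' j = 0" if "j \<ge> N" for j
    using that by (simp_all add: row_def N_def)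
  have C: "card (diagram u - diagram v) + (\<Sum>j<Suc N. row v j) = (\<Sum>j<Suc N. row u j)"
    if "strip u v" "u \<in> {p, q, y, y'}" for u v
    using that z by (intro card_diagram_diff) (auto simp: strip_def)
  have S: "(\<Sum>j<Suc N. row p j) + (\<Sum>j<Suc N. row y' j) + 2 * (\<Sum>j<Suc N. row z j)
      = (\<Sum>j<Suc N. row q j) + (\<Sum>j<Suc N. row y j) + 2 * (\<Sum>j<Suc N. row x' j)"
    "(\<Sum>j<Suc N. row q j) + (\<Sum>j<Suc N. row y' j) + 2 * (\<Sum>j<Suc N. row x j)
      = (\<Sum>j<Suc N. row p j) + (\<Sum>j<Suc N. row y j) + 2 * (\<Sum>j<Suc N. row z' j)"
    using sum_toggle[OF _ _ _ _ toggle_rows, of N] z px yx yz qz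
    unfolding strip_iff_interlaced by blast+
  show "card (diagram p - diagram x') + card (diagram y' - diagram x')
    = card (diagram y - diagram z) + card (diagram q - diagram z)"
    using C[OF strip_toggle(1)] C[OF strip_toggle(2)] C[OF yz] C[OF qz] S(1) by simp
  show "card (diagram y' - diagram z') + card (diagram q - diagram z')
    = card (diagram p - diagram x) + card (diagram y - diagram x)"
    using C[OF strip_toggle(3)] C[OF strip_toggle(4)] C[OF px] C[OF yx] S(2) by simp
qed

end

section \<open>Oscillating tableaux as chains of strips\<close>

text \<open>Taking the shape before step 1 to be empty gives step 1 the same form as the others,
  with nothing deleted.\<close>

definition prev :: "nat list list \<Rightarrow> nat \<Rightarrow> nat list" where
  "prev S i = (if i \<le> 1 then [] else upper S (i - 1))"

lemma deleted_eq_prev: "deleted S i = diagram (prev S i) - diagram (lower S i)"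
  by (simp add: deleted_def prev_def diagram_def)

lemma wt_eq_card_diagram:
  assumes "length S = 2 * k - 1" "j \<in> {1..k}"
  shows "wt j S = card (diagram (prev S j) - diagram (lower S j))
    + card (diagram (upper S j) - diagram (lower S j))"
  using assms by (subst wt_eq_card) (auto simp: deleted_eq_prev added_def)

text \<open>The conditions are regrouped by steps, one strip deleted and one added in each, since
  the toggle acts on two adjacent steps.\<close>

lemma is_SSOT_iff_strip:
  assumes "k \<ge> 1"
  shows "is_SSOT k lam S \<longleftrightarrow> length S = 2 * k - 1 \<and> upper S k = lam \<and>
    (\<forall>j \<in> {1..k}. strip (prev S j) (lower S j) \<and> strip (upper S j) (lower S j))"
    (is "_ \<longleftrightarrow> ?R")
proof
  assume S: "is_SSOT k lam S"
  then have len: "length S = 2 * k - 1" and part: "\<And>p. p \<in> set S \<Longrightarrow> is_partition p"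
    by (auto simp: is_SSOT_def)
  have empty: "is_partition []" by (simp add: is_partition_def)
  have parts: "is_partition (upper S j)" "is_partition (lower S j)" if "j \<in> {1..k}" for j
    using that len empty by (auto simp: upper_def lower_def intro!: part nth_mem)
  have "strip (prev S j) (lower S j)" if "j \<in> {1..k}" for j
  proof (cases "j = 1")
    case True
    then show ?thesis
      using empty by (simp add: prev_def lower_def strip_def horizontal_strip_def)
  next
    case False
    then have j: "j - 1 \<in> {1..k-1}" "j - 1 \<in> {1..k}" "j - 1 + 1 = j" "prev S j = upper S (j - 1)"
      using that by (auto simp: prev_def)
    have "\<forall>i \<in> {1..k-1}. diagram (lower S (i + 1)) \<subseteq> diagram (upper S i) \<and>
        horizontal_strip (diagram (upper S i) - diagram (lower S (i + 1)))"
      using S by (simp add: is_SSOT_def)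
    from bspec[OF this j(1)] show ?thesis
      using parts(1)[OF j(2)] parts(2)[OF that] unfolding strip_def j(3,4) by simp
  qed
  moreover have "strip (upper S j) (lower S j)" if "j \<in> {1..k}" for j
    using S parts[OF that] that by (simp add: is_SSOT_def strip_def)
  ultimately show ?R using S by (simp add: is_SSOT_def)
next
  assume R: ?R
  have "is_partition (S ! m)" if "m < length S" for m
  \<comment> \<open>Even positions hold some \<open>upper S j\<close>, odd ones some
    \<open>lower S j\<close> with \<open>j \<ge> 2\<close>.\<close>
  proof (cases "even m")
    case True
    then have "S ! m = upper S (m div 2 + 1)" "m div 2 + 1 \<in> {1..k}"
      using that R by (auto simp: upper_def)
    then show ?thesis using R by (simp add: strip_def)
  next
    case False
    then obtain l where "m = 2 * l + 1" by (elim oddE)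
    then have "S ! m = lower S (l + 2)" "l + 2 \<in> {1..k}"
      using that R by (auto simp: lower_def)
    then show ?thesis using R by (metis strip_def)
  qed
  then have "\<forall>p \<in> set S. is_partition p" by (auto simp: in_set_conv_nth)
  moreover have "strip (upper S j) (lower S (j + 1))" if "j \<in> {1..k-1}" for j
  proof -
    have "j + 1 \<in> {1..k}" "prev S (j + 1) = upper S j" using that by (auto simp: prev_def)
    then show ?thesis using R by metis
  qed
  ultimately show "is_SSOT k lam S" using R by (simp add: is_SSOT_def strip_def)
qed

section \<open>The toggle inside an oscillating tableau\<close>

text \<open>If \<open>a = b\<close>, the value \<open>x0\<close> is arbitrary because the write at
  \<open>b\<close> comes later. This covers step 1, whose lower shape is not stored.\<close>

lemma list_update_restore:
  fixes xs :: "'a list"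
  assumes "xs ! a = x0 \<or> a = b" "xs ! b = y0" "xs ! c = z0"
  shows "xs[a := x, b := y, c := z, a := x0, b := y0, c := z0] = xs"
proof -
  have "ys[l := v] ! m = (if l = m then v else ys ! m)" if "m < length ys" for l m v and ys :: "'a list"
    using that by (cases "l = m") simp_all
  then show ?thesis
    using assms by (intro nth_equalityI) auto
qed

text \<open>For \<open>i = 1\<close> the truncated index \<open>2 * i - 3\<close> is \<open>2 * i - 2\<close>, so the first of the three updates is
  overwritten by the second; \<open>x\<close> is empty in that case.\<close>

definition toggle_step :: "nat \<Rightarrow> nat list list \<Rightarrow> nat list list" where
  "toggle_step i S =
    (case toggle_partitions (prev S i) (upper S (i + 1)) (lower S i, upper S i, lower S (i + 1))
     of (x, y, z) \<Rightarrow> S[2 * i - 3 := x, 2 * i - 2 := y, 2 * i - 1 := z])"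

context
  fixes k i :: nat and lam S x y z
  assumes i: "1 \<le> i" "i \<le> k - 1" and S: "is_SSOT k lam S"
    and xyz: "toggle_partitions (prev S i) (upper S (i + 1)) (lower S i, upper S i, lower S (i + 1))
      = (x, y, z)"
begin

lemma k_pos: "k \<ge> 1"
  using i by simp

lemma length_SSOT: "length S = 2 * k - 1"
  using S by (simp add: is_SSOT_def)

lemma prev_Suc: "prev S (i + 1) = upper S i"
  using i by (simp add: prev_def)

lemma strip_SSOT:
  assumes "j \<in> {1..k}"
  shows "strip (prev S j) (lower S j)" "strip (upper S j) (lower S j)"
  using S assms unfolding is_SSOT_iff_strip[OF k_pos] by blast+

lemma strips_SSOT:
  "strip (prev S i) (lower S i)" "strip (upper S i) (lower S i)"
  "strip (upper S i) (lower S (i + 1))" "strip (upper S (i + 1)) (lower S (i + 1))"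
proof -
  have "i \<in> {1..k}" "i + 1 \<in> {1..k}" using i by auto
  then show "strip (prev S i) (lower S i)" "strip (upper S i) (lower S i)"
    "strip (upper S i) (lower S (i + 1))" "strip (upper S (i + 1)) (lower S (i + 1))"
    using strip_SSOT[of i] strip_SSOT[of "i + 1"] unfolding prev_Suc by blast+
qed

lemma toggle_step_eq: "toggle_step i S = S[2 * i - 3 := x, 2 * i - 2 := y, 2 * i - 1 := z]"
  unfolding toggle_step_def xyz by simp

lemma nth_toggle_step:
  "toggle_step i S ! m =
    (if m = 2 * i - 1 then z else if m = 2 * i - 2 then y else if m = 2 * i - 3 then x else S ! m)"
proof -
  have "2 * i - 1 < length S" "2 * i - 2 < length S" "2 * i - 3 < length S"
    using i unfolding length_SSOT by linarith+
  then show ?thesis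
    unfolding toggle_step_eq by (metis length_list_update nth_list_update)
qed

lemma length_toggle_step: "length (toggle_step i S) = 2 * k - 1"
  by (simp add: toggle_step_eq length_SSOT)

lemma upper_toggle_step:
  assumes "j \<ge> 1"
  shows "upper (toggle_step i S) j = (if j = i then y else upper S j)"
proof -
  \<comment> \<open>\<open>2 * i - 3\<close> is odd unless \<open>i = 1\<close>; then truncation
    gives 0, which forces \<open>j = i\<close>.\<close>
  have "2 * j - 2 \<noteq> 2 * i - 1" "2 * j - 2 = 2 * i - 2 \<longleftrightarrow> j = i"
    "2 * j - 2 \<noteq> 2 * i - 3 \<or> j = i"
    using assms i by presburger+
  then show ?thesis
    unfolding upper_def nth_toggle_step by (smt (verit))
qed

lemma lower_toggle_step:
  "lower (toggle_step i S) j = (if j = i then x else if j = i + 1 then z else lower S j)"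
proof (cases "j \<le> 1")
  case True
  \<comment> \<open>For \<open>i = 1\<close> the new lower shape is discarded from the list, so it
    has to be empty; it lies inside the empty previous shape.\<close>
  have "x = []" if "i = 1"
  proof -
    have "strip [] x"
      using strip_toggle(1)[OF strips_SSOT xyz] that by (simp add: prev_def)
    then have "row x 0 \<le> 0" "is_partition x"
      using interlacedD(1)[of "row []" "row x" 0] by (simp_all add: strip_iff_interlaced row_def)
    then show ?thesis using row_pos[of x 0] by fastforce
  qed
  then show ?thesis using True i by (auto simp: lower_def)
next
  case False
  then have index: "2 * j - 3 = 2 * i - 1 \<longleftrightarrow> j = i + 1" "2 * j - 3 = 2 * i - 2 \<longleftrightarrow> False"
    "2 * j - 3 = 2 * i - 3 \<longleftrightarrow> j = i"
    using i by presburger+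
  show ?thesis
    using False unfolding lower_def nth_toggle_step index by simp
qed

lemma prev_toggle_step: "prev (toggle_step i S) j = (if j = i + 1 then y else prev S j)"
  using upper_toggle_step[of "j - 1"] i by (auto simp: prev_def)

lemma is_SSOT_toggle_step: "is_SSOT k lam (toggle_step i S)"
proof -
  have k_neq: "k \<noteq> i" using i by linarith
  have "upper (toggle_step i S) k = lam"
    using S k_neq unfolding upper_toggle_step[OF k_pos] is_SSOT_def by simp
  moreover have "strip (prev (toggle_step i S) j) (lower (toggle_step i S) j)"
    "strip (upper (toggle_step i S) j) (lower (toggle_step i S) j)" if "j \<in> {1..k}" for j
  proof -
    have "j \<ge> 1" using that by simp
    show "strip (prev (toggle_step i S) j) (lower (toggle_step i S) j)"
      "strip (upper (toggle_step i S) j) (lower (toggle_step i S) j)"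
      using strip_toggle[OF strips_SSOT xyz] strip_SSOT[OF that]
      unfolding upper_toggle_step[OF \<open>j \<ge> 1\<close>] lower_toggle_step prev_toggle_step by auto
  qed
  ultimately show ?thesis
    unfolding is_SSOT_iff_strip[OF k_pos] using length_toggle_step by blast
qed

text \<open>The outer shapes \<open>prev S i\<close> and \<open>upper S (i + 1)\<close> are fixed,
  so the second application toggles the new triple between the same ends.\<close>

lemma toggle_step_toggle_step: "toggle_step i (toggle_step i S) = S"
proof -
  have step: "prev (toggle_step i S) i = prev S i" "upper (toggle_step i S) (i + 1) = upper S (i + 1)"
    "lower (toggle_step i S) i = x" "upper (toggle_step i S) i = y"
    "lower (toggle_step i S) (i + 1) = z"
    using i(1) by (simp_all add: upper_toggle_step lower_toggle_step prev_toggle_step)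
  have "toggle_step i (toggle_step i S) = (toggle_step i S)
      [2 * i - 3 := lower S i, 2 * i - 2 := upper S i, 2 * i - 1 := lower S (i + 1)]"
    unfolding toggle_step_def[of i "toggle_step i S"] step
      toggle_partitions_toggle_partitions[OF strips_SSOT xyz] prod.case ..
  also have "\<dots> = S"
  proof -
    have "S ! (2 * i - 3) = lower S i \<or> 2 * i - 3 = 2 * i - 2"
      using i(1) by (auto simp: lower_def)
    moreover have "S ! (2 * i - 2) = upper S i" "S ! (2 * i - 1) = lower S (i + 1)"
      using i(1) by (simp_all add: upper_def lower_def)
    ultimately show ?thesis
      unfolding toggle_step_eq by (rule list_update_restore)
  qed
  finally show ?thesis .
qed

lemma wt_toggle_step:
  "wt i (toggle_step i S) = wt (i + 1) S"
  "wt (i + 1) (toggle_step i S) = wt i S"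
  "j \<in> {1..k} - {i, i + 1} \<Longrightarrow> wt j (toggle_step i S) = wt j S"
proof -
  have ik: "i \<in> {1..k}" "i + 1 \<in> {1..k}" using i by auto
  note wt = wt_eq_card_diagram[OF length_SSOT] wt_eq_card_diagram[OF length_toggle_step]
  note step = upper_toggle_step lower_toggle_step prev_toggle_step
  show "wt i (toggle_step i S) = wt (i + 1) S"
    using card_toggle(1)[OF strips_SSOT xyz] i
    unfolding wt(1)[OF ik(2)] wt(2)[OF ik(1)] prev_Suc by (simp add: step)
  show "wt (i + 1) (toggle_step i S) = wt i S"
    using card_toggle(2)[OF strips_SSOT xyz] i
    unfolding wt(1)[OF ik(1)] wt(2)[OF ik(2)] by (simp add: step)
  show "wt j (toggle_step i S) = wt j S" if "j \<in> {1..k} - {i, i + 1}"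
    using that wt[of j] by (simp add: step)
qed

text \<open>The length is the sum of the weights, and two of these are merely interchanged.\<close>

lemma len_toggle_step: "len (toggle_step i S) = len S"
proof -
  have k: "(2 * k - 1 + 1) div 2 = k" using i by simp
  have sub: "{i, i + 1} \<subseteq> {1..k}" using i by auto
  show ?thesis
    unfolding len_eq_sum_wt length_SSOT length_toggle_step k
      sum.subset_diff[OF sub finite_atLeastAtMost]
    using wt_toggle_step by simp
qed

end

theorem lemma4p26:
  fixes k n i :: nat and lam :: "nat list"
  assumes "k \<ge> 1" and "is_partition lam" and "1 \<le> i" and "i \<le> k - 1"
  shows "\<exists>g. g \<in> SSOT k n lam \<rightarrow> SSOT k n lam \<and>
           (\<forall>S \<in> SSOT k n lam.
              g (g S) = S \<and>
              (wt i (g S), wt (i + 1) (g S)) = (wt (i + 1) S, wt i S) \<and>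
              (\<forall>j \<in> {1..k} - {i, i + 1}. wt j (g S) = wt j S))"
proof -
  have "toggle_step i S \<in> SSOT k n lam \<and> toggle_step i (toggle_step i S) = S \<and>
      (wt i (toggle_step i S), wt (i + 1) (toggle_step i S)) = (wt (i + 1) S, wt i S) \<and>
      (\<forall>j \<in> {1..k} - {i, i + 1}. wt j (toggle_step i S) = wt j S)"
    if "S \<in> SSOT k n lam" for S
  proof -
    have S: "is_SSOT k lam S" "len S = n" using that by (simp_all add: SSOT_def)
    obtain x y z where xyz: "toggle_partitions (prev S i) (upper S (i + 1))
        (lower S i, upper S i, lower S (i + 1)) = (x, y, z)"
      by (rule prod_cases3)
    note ctx = assms(3,4) S(1) xyz
    show ?thesis
      using is_SSOT_toggle_step[OF ctx] toggle_step_toggle_step[OF ctx] wt_toggle_step[OF ctx]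
        len_toggle_step[OF ctx] S(2)
      by (simp add: SSOT_def)
  qed
  then show ?thesis by (intro exI[of _ "toggle_step i"]) blast
qed

end
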